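(* Let $m,n>0$ be real numbers and let $g=e^{-2mt}dx^2+e^{2nt}dy^2+dt^2$ on $\mathrm{Sol}^3_{m,n}$, with orthonormal frame $e_1=e^{mt}\partial_x$, $e_2=e^{-nt}\partial_y$, $e_3=\partial_t$. Let $X=X_1(t)e_1+X_2(t)e_2+X_3(t)e_3$ be a smooth vector field on $\mathrm{Sol}^3_{m,n}$ whose components $X_1,X_2,X_3$ depend only on $t$. Then $X$ is a harmonic section with respect to $g$ if and only if $$\begin{cases}X_1''+(n-m)X_1'-m^2X_1=0,\\ X_2''+(n-m)X_2'-n^2X_2=0,\\ X_3''+(n-m)X_3'-(m^2+n^2)X_3=0,\end{cases}$$ where primes denote derivatives with respect to $t$.
   Context: For real $m,n>0$, $\mathrm{Sol}^3_{m,n}$ is the semidirect product $\mathbb{R}^2\rtimes_U\mathbb{R}$ with $U(t)=\mathrm{diag}(e^{mt},e^{-nt})$; its underlying manifold is $\mathbb{R}^3$ with global coordinates $(x,y,t)$. It carries the left-invariant Riemannian metric $g=e^{-2mt}dx^2+e^{2nt}dy^2+dt^2$. A smooth vector field $X$ on a Riemannian manifold $(M,g)$ is a harmonic section if it is a critical point of the vertical energy $E^v(X;D)=\frac12\int_D|\nabla X|^2v^g$ ($D\subset M$ compact domains); the Euler-Lagrange equation is $\overline{\Delta}X=\operatorname{Tr}_g\nabla^2X=\sum_i\left[\nabla_{e_i}\nabla_{e_i}X-\nabla_{\nabla_{e_i}e_i}X\right]=0$, for $\{e_i\}$ a local orthonormal frame and $\nabla$ the Levi-Civita connection. *)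

theory Defs
  imports "HOL-Analysis.Analysis"
begin

definition dir_deriv :: "'a::real_normed_vector \<Rightarrow> ('a \<Rightarrow> 'b::real_normed_vector) \<Rightarrow> 'a \<Rightarrow> 'b" where
  "dir_deriv v f p = frechet_derivative f (at p) v"

text \<open>All iterated directional derivatives exist and are Frechet differentiable everywhere (hence
  continuous); on a finite-dimensional domain this is the usual class of infinitely
  differentiable maps.\<close>

definition smooth :: "('a::euclidean_space \<Rightarrow> 'b::real_normed_vector) \<Rightarrow> bool" where
  "smooth f \<longleftrightarrow> (\<forall>vs. foldr dir_deriv vs f differentiable_on UNIV)"

text \<open>A metric is given by its Gram matrix \<open>g p\<close> in the coordinate frame at every point \<open>p\<close>, and a
  vector field by its components in that frame.\<close>

type_synonym 'n metric = "real ^ 'n \<Rightarrow> real ^ 'n ^ 'n"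
type_synonym 'n vfield = "real ^ 'n \<Rightarrow> real ^ 'n"

definition metric_inner :: "'n::finite metric \<Rightarrow> real ^ 'n \<Rightarrow> real ^ 'n \<Rightarrow> real ^ 'n \<Rightarrow> real" where
  "metric_inner g p u v = u \<bullet> (g p *v v)"

definition coord_partial :: "'n::finite \<Rightarrow> (real ^ 'n \<Rightarrow> real) \<Rightarrow> real ^ 'n \<Rightarrow> real" where
  "coord_partial i = dir_deriv (axis i 1)"

definition christoffel :: "'n::finite metric \<Rightarrow> real ^ 'n \<Rightarrow> 'n \<Rightarrow> 'n \<Rightarrow> 'n \<Rightarrow> real" where
  "christoffel g p k i j =
     (1/2) * (\<Sum>l\<in>UNIV. matrix_inv (g p) $ k $ l *
       (coord_partial i (\<lambda>q. g q $ j $ l) p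
        + coord_partial j (\<lambda>q. g q $ i $ l) p
        - coord_partial l (\<lambda>q. g q $ i $ j) p))"

text \<open>The Levi-Civita covariant derivative of the field \<open>X\<close> at \<open>p\<close> in the direction of the
  tangent vector \<open>v\<close>.\<close>

definition levi_civita :: "'n::finite metric \<Rightarrow> real ^ 'n \<Rightarrow> 'n vfield \<Rightarrow> 'n vfield" where
  "levi_civita g v X p =
     (\<chi> k. dir_deriv v (\<lambda>q. X q $ k) p
          + (\<Sum>i\<in>UNIV. \<Sum>j\<in>UNIV. christoffel g p k i j * v $ i * X p $ j))"

lemma christoffel_symmetric:
  assumes "\<And>q. transpose (g q) = g q"
  shows "christoffel g p k i j = christoffel g p k j i"
proof -
  have "g q $ i $ j = g q $ j $ i" for q
    using assms[of q] by (metis transpose_def vec_lambda_beta)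
  then show ?thesis
    unfolding christoffel_def by (simp add: add.commute)
qed

lemma christoffel_metric_compatible:
  fixes g :: "'n::finite metric"
  assumes sym: "\<And>q. transpose (g q) = g q" and inv: "invertible (g p)"
  shows "coord_partial k (\<lambda>q. g q $ i $ j) p =
     (\<Sum>l\<in>UNIV. christoffel g p l k i * g p $ l $ j)
     + (\<Sum>l\<in>UNIV. christoffel g p l k j * g p $ l $ i)"
proof -
  have s: "g q $ a $ b = g q $ b $ a" for q a b
    using sym[of q] by (metis transpose_def vec_lambda_beta)
  have lower: "(\<Sum>l\<in>UNIV. christoffel g p l a b * g p $ l $ c) =
      (1/2) * (coord_partial a (\<lambda>q. g q $ b $ c) p
        + coord_partial b (\<lambda>q. g q $ a $ c) p - coord_partial c (\<lambda>q. g q $ a $ b) p)" for a b c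
  proof -
    define T where "T r = coord_partial a (\<lambda>q. g q $ b $ r) p
        + coord_partial b (\<lambda>q. g q $ a $ r) p - coord_partial r (\<lambda>q. g q $ a $ b) p" for r
    have "g p ** matrix_inv (g p) = mat 1"
      using inv unfolding invertible_def matrix_inv_def by (rule someI2_ex) simp
    then have "(g p ** matrix_inv (g p)) $ c $ r = (if c = r then 1 else 0)" for r
      by (simp add: mat_def)
    then have d: "(\<Sum>l\<in>UNIV. g p $ c $ l * matrix_inv (g p) $ l $ r) = (if c = r then 1 else 0)" for r
      by (simp add: matrix_matrix_mult_def)
    have "(\<Sum>l\<in>UNIV. christoffel g p l a b * g p $ l $ c)
        = (\<Sum>l\<in>UNIV. \<Sum>r\<in>UNIV. (1/2) * T r * (g p $ c $ l * matrix_inv (g p) $ l $ r))"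
      unfolding christoffel_def T_def[symmetric]
      by (intro sum.cong refl)
        (simp add: s[of p _ c] sum_distrib_left sum_distrib_right mult_ac)
    also have "\<dots> = (\<Sum>r\<in>UNIV. \<Sum>l\<in>UNIV. (1/2) * T r * (g p $ c $ l * matrix_inv (g p) $ l $ r))"
      by (rule sum.swap)
    also have "\<dots> = (\<Sum>r\<in>UNIV. (1/2) * T r * (if c = r then 1 else 0))"
      by (simp only: sum_distrib_left[symmetric] d)
    also have "\<dots> = (\<Sum>r\<in>UNIV. if c = r then (1/2) * T r else 0)"
      by (intro sum.cong) auto
    also have "\<dots> = (1/2) * T c"
      by simp
    finally show ?thesis unfolding T_def .
  qed
  have f: "(\<lambda>q. g q $ a $ b) = (\<lambda>q. g q $ b $ a)" for a b
    using s by blast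
  show ?thesis
    unfolding lower f[of j i] f[of k i] f[of k j] by (simp add: field_simps)
qed

text \<open>The squared norm \<open>g\<^sup>i\<^sup>j g(\<nabla>\<^sub>i X, \<nabla>\<^sub>j X)\<close>, which equals the sum of \<open>g(\<nabla>\<^sub>e X, \<nabla>\<^sub>e X)\<close> over
  any orthonormal frame.\<close>

definition nabla_norm_sq :: "'n::finite metric \<Rightarrow> 'n vfield \<Rightarrow> real ^ 'n \<Rightarrow> real" where
  "nabla_norm_sq g X p =
     (\<Sum>i\<in>UNIV. \<Sum>j\<in>UNIV. matrix_inv (g p) $ i $ j *
        metric_inner g p (levi_civita g (axis i 1) X p) (levi_civita g (axis j 1) X p))"

definition vertical_energy :: "'n::finite metric \<Rightarrow> (real ^ 'n) set \<Rightarrow> 'n vfield \<Rightarrow> real" where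
  "vertical_energy g D X =
     (1/2) * set_lebesgue_integral lborel D (\<lambda>p. nabla_norm_sq g X p * sqrt (det (g p)))"

definition compact_domain :: "(real ^ 'n::finite) set \<Rightarrow> bool" where
  "compact_domain D \<longleftrightarrow> compact D \<and> (\<exists>U. open U \<and> connected U \<and> U \<noteq> {} \<and> D = closure U)"

text \<open>Criticality is meant in the space of smooth vector fields: the first variation vanishes for
  every smooth field supported in the domain of integration.\<close>

definition harmonic_section :: "'n::finite metric \<Rightarrow> 'n vfield \<Rightarrow> bool" where
  "harmonic_section g X \<longleftrightarrow> smooth X \<and>
     (\<forall>D V. compact_domain D \<and> smooth V \<and> closure {p. V p \<noteq> 0} \<subseteq> D \<longrightarrow>
        ((\<lambda>s. vertical_energy g D (\<lambda>p. X p + s *\<^sub>R V p)) has_real_derivative 0) (at 0))"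

text \<open>The coordinates \<open>x, y, t\<close> of \<open>p\<close> are \<open>p $ 1, p $ 2, p $ 3\<close>.\<close>

definition sol_metric :: "real \<Rightarrow> real \<Rightarrow> 3 metric" where
  "sol_metric m n p =
     vector [vector [exp (- 2 * m * p $ 3), 0, 0],
             vector [0, exp (2 * n * p $ 3), 0],
             vector [0, 0, 1]]"

definition sol_e1 :: "real \<Rightarrow> 3 vfield" where
  "sol_e1 m p = exp (m * p $ 3) *\<^sub>R axis 1 1"

definition sol_e2 :: "real \<Rightarrow> 3 vfield" where
  "sol_e2 n p = exp (- n * p $ 3) *\<^sub>R axis 2 1"

definition sol_e3 :: "3 vfield" where
  "sol_e3 p = axis 3 1"

lemma sol_frame_orthonormal:
  "metric_inner (sol_metric m n) p (sol_e1 m p) (sol_e1 m p) = 1"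
  "metric_inner (sol_metric m n) p (sol_e2 n p) (sol_e2 n p) = 1"
  "metric_inner (sol_metric m n) p (sol_e3 p) (sol_e3 p) = 1"
  "metric_inner (sol_metric m n) p (sol_e1 m p) (sol_e2 n p) = 0"
  "metric_inner (sol_metric m n) p (sol_e1 m p) (sol_e3 p) = 0"
  "metric_inner (sol_metric m n) p (sol_e2 n p) (sol_e3 p) = 0"
  by (simp_all add: metric_inner_def sol_metric_def sol_e1_def sol_e2_def sol_e3_def
      matrix_vector_mult_def inner_vec_def sum_3 axis_def flip: exp_add)

end

theory Submission
  imports Defs "HOL-Computational_Algebra.Polynomial"
begin

text \<open>The vertical energy is quadratic in the variation, so its derivative at \<open>0\<close> in the direction
  \<open>V\<close> is the integral of \<open>\<langle>\<nabla>X, \<nabla>V\<rangle>\<close> against the volume density \<open>exp ((n - m) t)\<close>. For components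
  depending only on \<open>t\<close> this integrand is a coordinate divergence of a field supported where \<open>V\<close> is,
  minus the pairing of \<open>V\<close> with the weighted left-hand sides of the three equations. The divergence
  integrates to zero, and bump functions \<open>V\<close> detect any nonzero left-hand side.\<close>

section \<open>Smooth functions\<close>

text \<open>The rough Laplacian is never formed: criticality is stated through the energy, so the
  three equations have to come out of an integration by parts. A compact domain is only the closure
  of a connected open set, with no regularity of its boundary, so a divergence theorem with a
  boundary term is not at hand. The support condition on \<open>V\<close> replaces it: the
  divergence terms vanish off \<open>D\<close>, hence can be integrated over the whole space, where
  the integral of a directional derivative is zero. The field whose divergence is taken is the
  classical one with components \<open>sqrt(det g) * g^{ii} * g(nabla_i X, V)\<close>, the metric
  being diagonal. As \<open>smooth\<close> is a condition on all iterated directional derivatives,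
  closure rules and bump functions are derived from that description.\<close>

primrec diff_upto :: "nat \<Rightarrow> ('a::euclidean_space \<Rightarrow> 'b::real_normed_vector) \<Rightarrow> bool" where
  "diff_upto 0 f \<longleftrightarrow> f differentiable_on UNIV"
| "diff_upto (Suc k) f \<longleftrightarrow> f differentiable_on UNIV \<and> (\<forall>v. diff_upto k (dir_deriv v f))"

text \<open>\<open>foldr\<close> applies the last entry of \<open>vs\<close> first, while
  \<open>diff_upto\<close> peels off the derivative taken first; lists are therefore split at their
  end.\<close>

lemma diff_upto_iff_foldr:
  "diff_upto k f \<longleftrightarrow> (\<forall>vs. length vs \<le> k \<longrightarrow> foldr dir_deriv vs f differentiable_on UNIV)"
proof (induction k arbitrary: f)
  case (Suc k)
  have "(\<forall>vs. length vs \<le> Suc k \<longrightarrow> foldr dir_deriv vs f differentiable_on UNIV) \<longleftrightarrow>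
    f differentiable_on UNIV \<and>
    (\<forall>v vs. length vs \<le> k \<longrightarrow> foldr dir_deriv vs (dir_deriv v f) differentiable_on UNIV)"
    (is "?L \<longleftrightarrow> ?R")
  proof
    assume L: ?L
    have "foldr dir_deriv vs (dir_deriv v f) differentiable_on UNIV" if "length vs \<le> k" for v vs
      using L[rule_format, of "vs @ [v]"] that by simp
    moreover have "f differentiable_on UNIV"
      using L[rule_format, of "[]"] by simp
    ultimately show ?R by blast
  next
    assume R: ?R
    show ?L
    proof (intro allI impI)
      fix vs :: "'a list"
      assume "length vs \<le> Suc k"
      then show "foldr dir_deriv vs f differentiable_on UNIV"
        using R by (cases vs rule: rev_exhaust) auto
    qed
  qed
  then show ?case using Suc by simp
qed simp

lemma smooth_iff_diff_upto: "smooth f \<longleftrightarrow> (\<forall>k. diff_upto k f)"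
  unfolding smooth_def diff_upto_iff_foldr by blast

lemma smooth_differentiable: "smooth f \<Longrightarrow> f differentiable at p"
  unfolding smooth_iff_diff_upto
  by (metis diff_upto.simps(1) differentiable_on_def at_within_open open_UNIV UNIV_I)

lemma smooth_dir_deriv: "smooth f \<Longrightarrow> smooth (dir_deriv v f)"
  unfolding smooth_iff_diff_upto by (metis diff_upto.simps(2))

lemma smooth_continuous_on: "smooth f \<Longrightarrow> continuous_on A f"
  by (meson smooth_differentiable differentiable_imp_continuous_within continuous_at_imp_continuous_on)

lemma smooth_has_derivative:
  assumes "smooth f"
  shows "(f has_derivative (\<lambda>v. dir_deriv v f p)) (at p)"
  using smooth_differentiable[OF assms, of p] unfolding dir_deriv_def
  by (simp add: frechet_derivative_works)

lemma dir_deriv_eqI: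
  assumes "\<And>p. (f has_derivative f' p) (at p)"
  shows "dir_deriv v f = (\<lambda>p. f' p v)"
  using frechet_derivative_at[OF assms] by (auto simp: dir_deriv_def fun_eq_iff)

text \<open>Smoothness is the largest property that implies differentiability and survives every
  directional derivative, so it suffices to exhibit one invariant class containing
  \<open>f\<close>.\<close>

lemma smooth_coinduct:
  assumes "P f"
    and "\<And>f p. P f \<Longrightarrow> f differentiable at p"
    and "\<And>f v. P f \<Longrightarrow> P (dir_deriv v f)"
  shows "smooth f"
proof -
  have "diff_upto k f" if "P f" for k f
    using that assms(2,3)
    by (induction k arbitrary: f) (auto simp: differentiable_on_def)
  then show ?thesis using assms(1) by (simp add: smooth_iff_diff_upto)
qed

lemma diff_upto_differentiable: "diff_upto k f \<Longrightarrow> f differentiable at p"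
  by (cases k) (auto simp: differentiable_on_def)

lemma diff_upto_Suc_D: "diff_upto (Suc k) f \<Longrightarrow> diff_upto k f"
  unfolding diff_upto_iff_foldr by simp

lemma diff_upto_has_derivative:
  assumes "diff_upto k f"
  shows "(f has_derivative (\<lambda>v. dir_deriv v f p)) (at p)"
  using diff_upto_differentiable[OF assms, of p] unfolding dir_deriv_def
  by (simp add: frechet_derivative_works)

section \<open>Closure properties of smooth functions\<close>

lemma smooth_const [intro]: "smooth (\<lambda>p. c)"
proof (rule smooth_coinduct[where P = "\<lambda>f. \<exists>c. f = (\<lambda>p. c)"])
  fix f :: "'a \<Rightarrow> 'b" and v :: 'a
  assume "\<exists>c. f = (\<lambda>p. c)"
  then show "\<exists>c. dir_deriv v f = (\<lambda>p. c)"
    by (auto simp: dir_deriv_eqI[OF has_derivative_const])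
qed auto

lemma dir_deriv_affine_comp:
  assumes "smooth f" "bounded_linear L"
  shows "dir_deriv v (\<lambda>p. f (L p + c)) = (\<lambda>p. dir_deriv (L v) f (L p + c))"
proof (rule dir_deriv_eqI)
  fix p
  have "((\<lambda>p. L p + c) has_derivative L) (at p)"
    using assms(2) by (auto intro!: derivative_eq_intros bounded_linear_imp_has_derivative)
  from has_derivative_compose[OF this smooth_has_derivative[OF assms(1)]]
  show "((\<lambda>p. f (L p + c)) has_derivative (\<lambda>v. dir_deriv (L v) f (L p + c))) (at p)" .
qed

text \<open>By the chain rule the derivative along \<open>v\<close> is
  \<open>dir_deriv (L v) f\<close> composed with the same affine map, so the composites with this
  map form an invariant class.\<close>

lemma smooth_affine_comp:
  assumes "smooth f" "bounded_linear L"
  shows "smooth (\<lambda>p. f (L p + c))"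
proof (rule smooth_coinduct[where P = "\<lambda>h. \<exists>f. smooth f \<and> h = (\<lambda>p. f (L p + c))"])
  fix h p
  assume "\<exists>f. smooth f \<and> h = (\<lambda>p. f (L p + c))"
  then obtain f where f: "smooth f" "h = (\<lambda>p. f (L p + c))" by blast
  have "((\<lambda>p. L p + c) has_derivative L) (at p)"
    using assms(2) by (auto intro!: derivative_eq_intros bounded_linear_imp_has_derivative)
  from has_derivative_compose[OF this smooth_has_derivative[OF f(1)]]
  show "h differentiable at p" unfolding f(2) by (rule differentiableI)
next
  fix h v
  assume "\<exists>f. smooth f \<and> h = (\<lambda>p. f (L p + c))"
  then show "\<exists>f. smooth f \<and> dir_deriv v h = (\<lambda>p. f (L p + c))"
    using dir_deriv_affine_comp[OF _ assms(2)] smooth_dir_deriv by blast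
qed (use assms in blast)

lemma smooth_linear_comp:
  assumes "smooth f" "bounded_linear L"
  shows "smooth (\<lambda>p. f (L p))"
  using smooth_affine_comp[OF assms, of 0] by simp

lemma dir_deriv_comp_linear:
  assumes "smooth f" "bounded_linear L"
  shows "dir_deriv v (\<lambda>p. L (f p)) = (\<lambda>p. L (dir_deriv v f p))"
  by (rule dir_deriv_eqI)
    (rule bounded_linear.has_derivative[OF assms(2) smooth_has_derivative[OF assms(1)]])

lemma smooth_comp_linear:
  assumes "smooth f" "bounded_linear L"
  shows "smooth (\<lambda>p. L (f p))"
proof (rule smooth_coinduct[where P = "\<lambda>h. \<exists>f. smooth f \<and> h = (\<lambda>p. L (f p))"])
  fix h p
  assume "\<exists>f. smooth f \<and> h = (\<lambda>p. L (f p))"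
  then show "h differentiable at p"
    using bounded_linear.has_derivative[OF assms(2) smooth_has_derivative] differentiableI by blast
next
  fix h v
  assume "\<exists>f. smooth f \<and> h = (\<lambda>p. L (f p))"
  then show "\<exists>f. smooth f \<and> dir_deriv v h = (\<lambda>p. L (f p))"
    using dir_deriv_comp_linear[OF _ assms(2)] smooth_dir_deriv by blast
qed (use assms in blast)

lemma diff_upto_add: "diff_upto k f \<Longrightarrow> diff_upto k g \<Longrightarrow> diff_upto k (\<lambda>p. f p + g p)"
proof (induction k arbitrary: f g)
  case (Suc k)
  have "dir_deriv v (\<lambda>p. f p + g p) = (\<lambda>p. dir_deriv v f p + dir_deriv v g p)" for v
    by (rule dir_deriv_eqI)
      (intro has_derivative_add diff_upto_has_derivative[OF Suc.prems(1)]
        diff_upto_has_derivative[OF Suc.prems(2)])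
  then show ?case using Suc by (simp add: differentiable_on_add)
qed (simp add: differentiable_on_add)

lemma bounded_bilinear_differentiable:
  assumes "bounded_bilinear B" and f: "f differentiable at p" and g: "g differentiable at p"
  shows "(\<lambda>p. B (f p) (g p)) differentiable at p"
  using bounded_bilinear.FDERIV[OF assms(1) f[unfolded frechet_derivative_works]
    g[unfolded frechet_derivative_works]] by (rule differentiableI)

text \<open>The Leibniz rule turns one product into a sum of two, so single products are not an
  invariant class for \<open>smooth_coinduct\<close>. Counting the order works instead: both
  summands are products of factors of order \<open>k\<close>, the undifferentiated factor losing one
  order.\<close>

lemma diff_upto_bilinear:
  assumes "bounded_bilinear B"
  shows "diff_upto k f \<Longrightarrow> diff_upto k g \<Longrightarrow> diff_upto k (\<lambda>p. B (f p) (g p))"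
proof (induction k arbitrary: f g)
  case 0
  then show ?case
    by (simp add: differentiable_on_def bounded_bilinear_differentiable[OF assms])
next
  case (Suc k)
  have "dir_deriv v (\<lambda>p. B (f p) (g p)) =
      (\<lambda>p. B (f p) (dir_deriv v g p) + B (dir_deriv v f p) (g p))" for v
    by (rule dir_deriv_eqI)
      (intro bounded_bilinear.FDERIV[OF assms] diff_upto_has_derivative[OF Suc.prems(1)]
        diff_upto_has_derivative[OF Suc.prems(2)])
  moreover have "(\<lambda>p. B (f p) (g p)) differentiable_on UNIV"
    using Suc.prems by (simp add: differentiable_on_def bounded_bilinear_differentiable[OF assms])
  moreover have "diff_upto k (\<lambda>p. B (f p) (dir_deriv v g p) + B (dir_deriv v f p) (g p))" for v
    using Suc.prems diff_upto_Suc_D[of k f] diff_upto_Suc_D[of k g]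
    by (intro diff_upto_add Suc.IH) simp_all
  ultimately show ?case by simp
qed

lemma smooth_add [intro]: "smooth f \<Longrightarrow> smooth g \<Longrightarrow> smooth (\<lambda>p. f p + g p)"
  by (simp add: smooth_iff_diff_upto diff_upto_add)

lemma smooth_mult [intro]:
  fixes f g :: "'a::euclidean_space \<Rightarrow> real"
  shows "smooth f \<Longrightarrow> smooth g \<Longrightarrow> smooth (\<lambda>p. f p * g p)"
  by (simp add: smooth_iff_diff_upto diff_upto_bilinear[OF bounded_bilinear_mult])

lemma smooth_minus [intro]: "smooth f \<Longrightarrow> smooth (\<lambda>p. - f p)"
  by (rule smooth_comp_linear[OF _ bounded_linear_minus[OF bounded_linear_ident]])

lemma smooth_diff [intro]: "smooth f \<Longrightarrow> smooth g \<Longrightarrow> smooth (\<lambda>p. f p - g p)"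
  using smooth_add[OF _ smooth_minus, of f g] by simp

lemma smooth_nth [intro]:
  fixes f :: "'a::euclidean_space \<Rightarrow> real ^ 'n"
  shows "smooth f \<Longrightarrow> smooth (\<lambda>p. f p $ k)"
  by (rule smooth_comp_linear[OF _ bounded_linear_vec_nth])

lemma smooth_scaleR_const [intro]: 
  fixes f :: "'a::euclidean_space \<Rightarrow> real"
  shows "smooth f \<Longrightarrow> smooth (\<lambda>p. f p *\<^sub>R c)"
  by (rule smooth_comp_linear[OF _ bounded_linear_scaleR_left])

lemma dir_deriv_add:
  "smooth f \<Longrightarrow> smooth g \<Longrightarrow>
    dir_deriv v (\<lambda>p. f p + g p) = (\<lambda>p. dir_deriv v f p + dir_deriv v g p)"
  by (rule dir_deriv_eqI) (intro has_derivative_add smooth_has_derivative)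

lemma dir_deriv_mult:
  fixes f g :: "'a::euclidean_space \<Rightarrow> real"
  shows "smooth f \<Longrightarrow> smooth g \<Longrightarrow>
    dir_deriv v (\<lambda>p. f p * g p) = (\<lambda>p. f p * dir_deriv v g p + dir_deriv v f p * g p)"
  by (rule dir_deriv_eqI) (intro has_derivative_mult smooth_has_derivative)

lemma dir_deriv_real:
  fixes f :: "real \<Rightarrow> real"
  assumes "\<And>t. (f has_real_derivative f' t) (at t)"
  shows "dir_deriv v f = (\<lambda>t. v * f' t)"
  by (subst dir_deriv_eqI[OF assms[unfolded has_field_derivative_def]]) (simp add: mult.commute)

lemma smooth_has_real_derivative:
  fixes f :: "real \<Rightarrow> real"
  assumes "smooth f"
  shows "(f has_real_derivative deriv f t) (at t)"
  using smooth_differentiable[OF assms, of t]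
  by (metis DERIV_deriv_iff_real_differentiable)

lemma smooth_deriv:
  fixes f :: "real \<Rightarrow> real"
  assumes "smooth f"
  shows "smooth (deriv f)"
  using smooth_dir_deriv[OF assms, of 1] dir_deriv_real[OF smooth_has_real_derivative[OF assms], of 1]
  by simp

section \<open>Exponentials and bump functions on the line\<close>

lemma smooth_exp: "smooth (exp :: real \<Rightarrow> real)"
proof (rule smooth_coinduct[where P = "\<lambda>f. \<exists>c. f = (\<lambda>t. c * exp t)"])
  fix f :: "real \<Rightarrow> real" and v :: real
  assume "\<exists>c. f = (\<lambda>t. c * exp t)"
  then obtain c where f: "f = (\<lambda>t. c * exp t)" by blast
  have *: "((\<lambda>t. c * exp t) has_real_derivative c * exp t) (at t)" for t
    by (auto intro!: derivative_eq_intros)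
  show "\<exists>c. dir_deriv v f = (\<lambda>t. c * exp t)"
    unfolding f dir_deriv_real[OF *] by (auto intro!: exI[of _ "v * c"] simp: mult_ac)
next
  fix f :: "real \<Rightarrow> real" and p :: real
  assume "\<exists>c. f = (\<lambda>t. c * exp t)"
  then show "f differentiable at p"
    using DERIV_exp[of p] by (auto intro!: differentiable_mult simp: real_differentiable_def[of exp] simp del: DERIV_exp)
qed (rule exI[of _ 1], simp)

lemma smooth_exp_linear: "smooth (\<lambda>t::real. exp (c * t))"
  by (rule smooth_linear_comp[OF smooth_exp bounded_linear_mult_right])

text \<open>This family is closed under differentiation, so its members are smooth.\<close>

definition flat :: "real poly \<Rightarrow> real \<Rightarrow> real" where
  "flat q t = (if t > 0 then poly q (1 / t) * exp (- 1 / t) else 0)"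

lemma tendsto_poly_times_exp_neg:
  fixes q :: "real poly"
  shows "((\<lambda>u. poly q u * exp (- u)) \<longlongrightarrow> 0) at_top"
proof -
  have "((\<lambda>u::real. \<Sum>i\<le>degree q. coeff q i * (u ^ i / exp u)) \<longlongrightarrow>
      (\<Sum>i\<le>degree q. coeff q i * 0)) at_top"
    by (intro tendsto_intros tendsto_power_div_exp_0)
  then show ?thesis
    by (simp add: poly_altdef sum_distrib_right exp_minus divide_inverse mult.assoc)
qed

text \<open>From the right, \<open>u = 1 / t\<close> turns this into polynomial growth against
  exponential decay at infinity; from the left the function is zero.\<close>

lemma tendsto_flat_0: "(flat q \<longlongrightarrow> 0) (at 0)"
proof -
  have "((\<lambda>t::real. poly q (inverse t) * exp (- inverse t)) \<longlongrightarrow> 0) (at_right 0)"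
    by (rule filterlim_compose[OF tendsto_poly_times_exp_neg filterlim_inverse_at_top_right])
  then have "(flat q \<longlongrightarrow> 0) (at_right 0)"
    by (rule Lim_transform_eventually)
      (auto simp: flat_def eventually_at_right_less divide_simps eventually_at_filter)
  moreover have "(flat q \<longlongrightarrow> 0) (at_left 0)"
    by (rule Lim_transform_eventually[OF tendsto_const])
      (auto simp: flat_def eventually_at_filter)
  ultimately show ?thesis by (simp add: filterlim_split_at)
qed

text \<open>With \<open>u = 1 / t\<close> one has \<open>d/dt = - u^2 d/du\<close>, and
  differentiating \<open>q(u) exp(-u)\<close> in \<open>u\<close> gives
  \<open>(q' - q) exp(-u)\<close>. The two \<open>pCons 0\<close> are the factor
  \<open>u^2\<close>.\<close>

lemma flat_has_real_derivative:
  "(flat q has_real_derivative flat (pCons 0 (pCons 0 (q - pderiv q))) t) (at t)"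
proof -
  consider "t > 0" | "t < 0" | "t = 0" by linarith
  then show ?thesis
  proof cases
    case 1
    have "((\<lambda>t. poly q (1 / t) * exp (- 1 / t)) has_real_derivative
        flat (pCons 0 (pCons 0 (q - pderiv q))) t) (at t)"
      using 1 by (auto intro!: derivative_eq_intros poly_DERIV[THEN DERIV_chain2]
          simp: flat_def field_simps power2_eq_square)
    then show ?thesis
      by (rule DERIV_cong_ev[THEN iffD1, rotated 3, OF _])
        (use 1 in \<open>auto simp: flat_def intro: eventually_mono[OF eventually_nhds_in_open[of "{0<..}"]]\<close>)
  next
    case 2
    have "((\<lambda>t. 0) has_real_derivative flat (pCons 0 (pCons 0 (q - pderiv q))) t) (at t)"
      using 2 by (simp add: flat_def)
    then show ?thesis
      by (rule DERIV_cong_ev[THEN iffD1, rotated 3, OF _])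
        (use 2 in \<open>auto simp: flat_def intro: eventually_mono[OF eventually_nhds_in_open[of "{..<0}"]]\<close>)
  next
    case 3
    \<comment> \<open>The difference quotient at 0 has an extra factor \<open>1 / h\<close>, that is
      \<open>u\<close>, so it is again a member of the family and tends to 0. At
      \<open>h = 0\<close> both sides are 0, because division by zero yields 0.\<close>
    have "(\<lambda>h. (flat q h - flat q 0) / (h - 0)) = flat (pCons 0 q)"
      by (auto simp: flat_def fun_eq_iff)
    then have "(flat q has_real_derivative 0) (at 0)"
      using tendsto_flat_0[of "pCons 0 q"] by (simp add: DERIV_def)
    then show ?thesis using 3 by (simp add: flat_def)
  qed
qed

lemma smooth_flat: "smooth (flat q)"
proof (rule smooth_coinduct[where P = "\<lambda>f. \<exists>q. f = flat q"])
  fix f :: "real \<Rightarrow> real" and v :: real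
  assume "\<exists>q. f = flat q"
  then obtain q where f: "f = flat q" by blast
  show "\<exists>q. dir_deriv v f = flat q"
    unfolding f dir_deriv_real[OF flat_has_real_derivative]
    by (rule exI[of _ "smult v (pCons 0 (pCons 0 (q - pderiv q)))"]) (auto simp: flat_def)
next
  fix f :: "real \<Rightarrow> real" and p :: real
  assume "\<exists>q. f = flat q"
  then show "f differentiable at p"
    using flat_has_real_derivative by (auto simp: real_differentiable_def)
qed blast

definition bump :: "real \<Rightarrow> real \<Rightarrow> real \<Rightarrow> real" where
  "bump a b t = flat 1 (t - a) * flat 1 (b - t)"

lemma smooth_bump: "smooth (bump a b)"
proof -
  have "smooth (\<lambda>t. flat 1 (t + (- a)))"
    by (rule smooth_affine_comp[OF smooth_flat bounded_linear_ident])
  moreover have "smooth (\<lambda>t. flat 1 (- t + b))"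
    by (rule smooth_affine_comp[OF smooth_flat bounded_linear_minus[OF bounded_linear_ident]])
  ultimately show ?thesis
    unfolding bump_def[abs_def] using smooth_mult by (fastforce simp: algebra_simps)
qed

lemma bump_nonneg: "bump a b t \<ge> 0"
  by (auto simp: bump_def flat_def)

lemma bump_pos_iff: "bump a b t > 0 \<longleftrightarrow> a < t \<and> t < b"
  by (auto simp: bump_def flat_def zero_less_mult_iff)

lemma bump_eq_0_iff: "bump a b t = 0 \<longleftrightarrow> t \<le> a \<or> b \<le> t"
  using bump_pos_iff[of a b t] bump_nonneg[of a b t] by auto

section \<open>Integrals of derivatives and test functions\<close>

lemma integral_translation:
  fixes F :: "'a::euclidean_space \<Rightarrow> real"
  assumes "F \<in> borel_measurable borel"
  shows "(\<integral>p. F (c + p) \<partial>lborel) = (\<integral>p. F p \<partial>lborel)"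
proof -
  have "(\<integral>p. F p \<partial>lborel) = (\<integral>p. F p \<partial>(distr lborel borel ((+) c)))"
    by (simp add: lborel_distr_plus)
  also have "\<dots> = (\<integral>p. F (c + p) \<partial>lborel)"
    using assms by (intro integral_distr) auto
  finally show ?thesis by simp
qed

lemma dir_deriv_eq_0_outside:
  assumes "p \<notin> closure {p. F p \<noteq> 0}"
  shows "dir_deriv v F p = 0"
proof -
  have "((\<lambda>q. 0) has_derivative (\<lambda>v. 0)) (at p)" by simp
  then have "(F has_derivative (\<lambda>v. 0)) (at p)"
    by (rule has_derivative_transform_within_open[where s = "- closure {p. F p \<noteq> 0}"])
      (use assms closure_subset[of "{p. F p \<noteq> 0}"] in auto)
  from frechet_derivative_at[OF this] show ?thesis
    unfolding dir_deriv_def by (metis)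
qed

lemma integrable_of_compact_support:
  fixes F :: "'a::euclidean_space \<Rightarrow> real"
  assumes "continuous_on UNIV F" "compact K" "\<And>p. p \<notin> K \<Longrightarrow> F p = 0"
  shows "integrable lborel F"
proof -
  have "integrable lborel (\<lambda>p. indicator K p *\<^sub>R F p)"
    using assms by (intro borel_integrable_compact continuous_on_subset[OF assms(1)]) auto
  also have "(\<lambda>p. indicator K p *\<^sub>R F p) = F"
    using assms(3) by (auto simp: indicator_def fun_eq_iff)
  finally show ?thesis .
qed

text \<open>Differentiating \<open>\<integral>F(p + sv) dp\<close>, which does not depend on \<open>s\<close>, avoids Fubini.\<close>

lemma integral_dir_deriv_eq_0:
  fixes F :: "'a::euclidean_space \<Rightarrow> real"
  assumes F: "smooth F" and K: "compact K" and F0: "\<And>p. p \<notin> K \<Longrightarrow> F p = 0"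
  shows "(\<integral>p. dir_deriv v F p \<partial>lborel) = 0"
proof -
  have "closed K" using K by (rule compact_imp_closed)
  then have "closure {p. F p \<noteq> 0} \<subseteq> K"
    using F0 by (intro closure_minimal) auto
  then have D0: "dir_deriv v F p = 0" if "p \<notin> K" for p
    using dir_deriv_eq_0_outside[of p F v] that by blast
  have cF: "continuous_on UNIV F" and cD: "continuous_on UNIV (dir_deriv v F)"
    using F smooth_dir_deriv smooth_continuous_on by blast+
  have mF: "F \<in> borel_measurable borel" 
    using cF by (rule borel_measurable_continuous_onI)
  have mT: "(\<lambda>p. F (c + p)) \<in> borel_measurable borel" for c
    by (intro borel_measurable_continuous_onI continuous_on_compose2[OF cF] continuous_intros) auto
  have mD: "dir_deriv v F \<in> borel_measurable borel"
    using cD by (rule borel_measurable_continuous_onI)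
  have iF: "integrable lborel F"
    by (rule integrable_of_compact_support[OF cF K F0])
  \<comment> \<open>All difference quotients below use steps in \<open>(0, 1]\<close> along
    \<open>v\<close>. They vanish unless \<open>p\<close> or its shift lies in \<open>K\<close>, so
    moving \<open>K\<close> back by at most \<open>v\<close> gives one compact set containing all
    their supports.\<close>
  define K' where "K' = (\<lambda>z. fst z + snd z *\<^sub>R v) ` (K \<times> {-1..0})"
  have K': "compact K'"
    unfolding K'_def using K
    by (intro compact_continuous_image compact_Times continuous_intros) auto
  have "bounded (dir_deriv v F ` K)"
    using K by (intro compact_imp_bounded compact_continuous_image continuous_on_subset[OF cD]) auto
  then obtain M where M: "M > 0" "\<And>p. p \<in> K \<Longrightarrow> norm (dir_deriv v F p) \<le> M"
    unfolding bounded_pos by auto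
  then have M': "\<bar>dir_deriv v F p\<bar> \<le> M" for p
    using D0[of p] by (cases "p \<in> K") auto
  \<comment> \<open>The limit is taken along a sequence of positive steps so that dominated
    convergence applies.\<close>
  define h where "h = (\<lambda>i. inverse (real (Suc i)))"
  have h: "0 < h i" "h i \<le> 1" for i unfolding h_def by (auto simp: inverse_le_1_iff)
  have h0: "h \<longlonglongrightarrow> 0" unfolding h_def by (rule LIMSEQ_inverse_real_of_nat)
  define q where "q = (\<lambda>i p. (F (h i *\<^sub>R v + p) - F p) / h i)"
  have curve: "((\<lambda>s. F (s *\<^sub>R v + p)) has_real_derivative dir_deriv v F (s *\<^sub>R v + p)) (at s)" for s p
  proof -
    have "((\<lambda>s. s *\<^sub>R v + p) has_derivative (\<lambda>s. s *\<^sub>R v)) (at s)"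
      by (auto intro!: derivative_eq_intros)
    from has_derivative_compose[OF this smooth_has_derivative[OF F]]
    have "((\<lambda>s. F (s *\<^sub>R v + p)) has_derivative (\<lambda>r. dir_deriv (r *\<^sub>R v) F (s *\<^sub>R v + p))) (at s)" .
    moreover have "(\<lambda>r. dir_deriv (r *\<^sub>R v) F (s *\<^sub>R v + p)) = (*) (dir_deriv v F (s *\<^sub>R v + p))"
      using linear_scale[OF has_derivative_linear[OF smooth_has_derivative[OF F]]]
      by (auto simp: fun_eq_iff mult.commute)
    ultimately show ?thesis by (simp add: has_field_derivative_def)
  qed
  have q_lim: "(\<lambda>i. q i p) \<longlonglongrightarrow> dir_deriv v F p" for p
  proof -
    have "((\<lambda>s. (F (s *\<^sub>R v + p) - F p) / s) \<longlongrightarrow> dir_deriv v F p) (at 0)"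
      using curve[of p 0] by (simp add: DERIV_def)
    moreover have "filterlim h (at 0) sequentially"
      using h0 h(1) by (auto simp: filterlim_at intro!: always_eventually) (metis less_irrefl)
    ultimately show ?thesis unfolding q_def by (rule filterlim_compose)
  qed
  \<comment> \<open>By the mean value theorem a quotient is a value of \<open>dir_deriv v F\<close>,
    hence at most \<open>M\<close>, uniformly in the step.\<close>
  have q_bound: "norm (q i p) \<le> indicator K' p * M" for i p
  proof (cases "p \<in> K'")
    case True
    obtain z where "F (h i *\<^sub>R v + p) - F (0 *\<^sub>R v + p) = (h i - 0) * dir_deriv v F (z *\<^sub>R v + p)"
      using MVT2[OF h(1)[of i], of "\<lambda>s. F (s *\<^sub>R v + p)" "\<lambda>s. dir_deriv v F (s *\<^sub>R v + p)"] curve by blast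
    then have "q i p = dir_deriv v F (z *\<^sub>R v + p)"
      unfolding q_def using h(1)[of i] by simp
    then show ?thesis using M' True by simp
  next
    case False
    have "p \<notin> K"
    proof
      assume "p \<in> K"
      then have "fst (p, 0::real) + snd (p, 0::real) *\<^sub>R v \<in> K'"
        unfolding K'_def by (intro imageI) auto
      then show False using False by simp
    qed
    moreover have "h i *\<^sub>R v + p \<notin> K"
    proof
      assume "h i *\<^sub>R v + p \<in> K"
      then have "fst (h i *\<^sub>R v + p, - h i) + snd (h i *\<^sub>R v + p, - h i) *\<^sub>R v \<in> K'"
        unfolding K'_def using h[of i] by (intro imageI) auto
      then show False using False by simp
    qed
    ultimately show ?thesis using F0 M(1) by (simp add: q_def)
  qed
  have "(\<lambda>i. \<integral>p. q i p \<partial>lborel) \<longlonglongrightarrow> (\<integral>p. dir_deriv v F p \<partial>lborel)"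
  proof (rule integral_dominated_convergence[where w = "\<lambda>p. indicator K' p * M"])
    show "integrable lborel (\<lambda>p. indicator K' p * M)"
      using K' by (auto intro!: emeasure_compact_finite borel_compact integrable_mult_left)
  qed (use mD mF mT q_lim q_bound in \<open>auto simp: q_def intro!: measurable_lborel1\<close>)
  moreover have "(\<integral>p. q i p \<partial>lborel) = 0" for i
  proof -
    have "integrable lborel (\<lambda>p. F (h i *\<^sub>R v + p))"
      using iF mF lborel_distr_plus[of "h i *\<^sub>R v"]
        integrable_distr_eq[of "(+) (h i *\<^sub>R v)" lborel borel F] by simp
    then show ?thesis
      unfolding q_def using iF integral_translation[OF mF, of "h i *\<^sub>R v"]
      by simp
  qed
  ultimately show ?thesis using LIMSEQ_unique[OF _ tendsto_const] by fastforce
qed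

section \<open>Test functions in space\<close>

lemma smooth_prod [intro]:
  fixes f :: "'i \<Rightarrow> 'a::euclidean_space \<Rightarrow> real"
  assumes "\<And>i. i \<in> I \<Longrightarrow> smooth (f i)"
  shows "smooth (\<lambda>p. \<Prod>i\<in>I. f i p)"
  using assms by (induction I rule: infinite_finite_induct) auto

lemma smooth_of_coord:
  fixes c :: "real \<Rightarrow> real"
  assumes "smooth c"
  shows "smooth (\<lambda>p::real^'n. c (p $ i))"
  by (rule smooth_linear_comp[OF assms bounded_linear_vec_nth])

lemma compact_domain_cbox:
  assumes "box a b \<noteq> {}"
  shows "compact_domain (cbox a b)"
  unfolding compact_domain_def
proof (intro conjI compact_cbox exI[of _ "box a b"])
  show "cbox a b = closure (box a b)" using closure_box[OF assms] by simp
qed (simp_all add: assms convex_connected open_box)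

text \<open>This is the fundamental lemma of the calculus of variations: a continuous
  \<open>f\<close> keeps its sign on a small box around \<open>p0\<close>, and a bump supported in
  that box sees only this sign.\<close>

lemma exists_test_function:
  fixes f :: "real ^ 'n \<Rightarrow> real"
  assumes cf: "continuous_on UNIV f" and p0: "f p0 \<noteq> 0"
  obtains D \<eta> where "compact_domain D" "smooth \<eta>" "closure {p. \<eta> p \<noteq> 0} \<subseteq> D"
    "set_lebesgue_integral lborel D (\<lambda>p. f p * \<eta> p) \<noteq> 0"
proof -
  \<comment> \<open>Multiplying by the constant \<open>f p0\<close> makes the sign positive near
    \<open>p0\<close> and treats both signs at once.\<close>
  have "open ((\<lambda>p. f p * f p0) -` {0<..})"
    by (intro open_vimage continuous_intros cf)
  moreover have "p0 \<in> (\<lambda>p. f p * f p0) -` {0<..}"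
    using p0 by (auto simp: zero_less_mult_iff)
  ultimately obtain a b
    where ab: "cbox a b \<subseteq> (\<lambda>p. f p * f p0) -` {0<..}" "p0 \<in> box a b"
    by (rule open_contains_cbox)
  define \<eta> where "\<eta> = (\<lambda>p::real^'n. \<Prod>i\<in>UNIV. bump (a $ i) (b $ i) (p $ i))"
  have s\<eta>: "smooth \<eta>"
    unfolding \<eta>_def by (intro smooth_prod smooth_of_coord smooth_bump)
  have "p \<in> cbox a b" if "\<eta> p \<noteq> 0" for p
    using that by (auto simp: \<eta>_def bump_eq_0_iff mem_box_cart not_le less_imp_le)
  then have supp: "closure {p. \<eta> p \<noteq> 0} \<subseteq> cbox a b"
    by (intro closure_minimal) (auto simp: closed_cbox)
  have \<eta>0: "\<eta> p \<ge> 0" for p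
    unfolding \<eta>_def by (intro prod_nonneg) (simp add: bump_nonneg)
  have \<eta>p0: "\<eta> p0 > 0"
    unfolding \<eta>_def using ab(2) by (intro prod_pos) (simp add: bump_pos_iff mem_box_cart)
  have c\<eta>: "continuous_on (cbox a b) (\<lambda>p. f p * \<eta> p)"
    using smooth_continuous_on[OF s\<eta>] continuous_on_subset[OF cf]
    by (intro continuous_intros) auto
  then have int: "set_integrable lborel (cbox a b) (\<lambda>p. f p * \<eta> p)"
    unfolding set_integrable_def by (rule borel_integrable_compact[OF compact_cbox])
  have "set_lebesgue_integral lborel (cbox a b) (\<lambda>p. f p * \<eta> p) \<noteq> 0"
  proof
    assume 0: "set_lebesgue_integral lborel (cbox a b) (\<lambda>p. f p * \<eta> p) = 0"
    \<comment> \<open>After multiplication by \<open>f p0\<close> the integrand is continuous and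
      nonnegative on the box; a zero integral would force it to vanish at \<open>p0\<close>, where
      it is positive.\<close>
    have "((\<lambda>p. f p * \<eta> p) has_integral 0) (cbox a b)"
      using set_borel_integral_eq_integral[OF int] 0 by (simp add: has_integral_iff)
    from has_integral_mult_right[OF this, of "f p0"]
    have "((\<lambda>p. f p0 * (f p * \<eta> p)) has_integral 0) (cbox a b)" by simp
    moreover have "0 \<le> f p0 * (f p * \<eta> p)" if "p \<in> box a b" for p
    proof -
      have "0 < f p0 * f p" using ab(1) that box_subset_cbox[of a b] by (auto simp: mult.commute)
      then have "0 \<le> (f p0 * f p) * \<eta> p" by (rule mult_nonneg_nonneg[OF less_imp_le \<eta>0])
      then show ?thesis by (simp only: mult.assoc)
    qed
    moreover have "continuous_on (cbox a b) (\<lambda>p. f p0 * (f p * \<eta> p))"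
      by (intro continuous_intros c\<eta>)
    moreover have "p0 \<in> cbox a b" using ab(2) box_subset_cbox by blast
    ultimately have "f p0 * (f p0 * \<eta> p0) = 0"
      using ab(2) box_subset_cbox
      by (intro has_integral_0_cbox_imp_0[of a b "\<lambda>p. f p0 * (f p * \<eta> p)" p0]) auto
    then show False using p0 \<eta>p0 by simp
  qed
  moreover have "compact_domain (cbox a b)"
    using ab(2) by (intro compact_domain_cbox) auto
  ultimately show thesis using that s\<eta> supp by blast
qed

text \<open>Linearity of the connection in the field is what makes the energy a polynomial of degree
  two in \<open>s\<close>.\<close>

lemma levi_civita_add_scaleR:
  assumes "smooth X" "smooth V"
  shows "levi_civita g v (\<lambda>p. X p + s *\<^sub>R V p) p = levi_civita g v X p + s *\<^sub>R levi_civita g v V p"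
proof -
  have "dir_deriv v (\<lambda>q. X q $ k + s * V q $ k) =
      (\<lambda>p. dir_deriv v (\<lambda>q. X q $ k) p + s * dir_deriv v (\<lambda>q. V q $ k) p)" for k
    by (rule dir_deriv_eqI)
      (intro has_derivative_add has_derivative_mult_right smooth_has_derivative smooth_nth assms)
  then show ?thesis
    by (simp add: levi_civita_def vec_eq_iff sum.distrib sum_distrib_left algebra_simps)
qed

section \<open>The first variation on Sol\<close>

text \<open>\<open>matrix_inv\<close> is given by a choice operator; uniqueness of two-sided
  inverses makes it computable.\<close>

lemma matrix_inv_eqI:
  fixes A B :: "real^'n^'n"
  assumes "A ** B = mat 1" "B ** A = mat 1"
  shows "matrix_inv A = B"
proof -
  have "invertible A" using assms by (auto simp: invertible_def)
  then have "matrix_inv A ** A = mat 1"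
    unfolding invertible_def matrix_inv_def by (rule someI2_ex) simp
  then have "matrix_inv A ** (A ** B) = B"
    by (simp add: matrix_mul_assoc)
  then show ?thesis by (simp add: assms)
qed

lemma matrix_inv_sol_metric:
  "matrix_inv (sol_metric m n p) =
     vector [vector [exp (2 * m * p $ 3), 0, 0],
             vector [0, exp (- 2 * n * p $ 3), 0],
             vector [0, 0, 1]]"
  by (rule matrix_inv_eqI)
    (simp_all add: sol_metric_def matrix_matrix_mult_def mat_def vec_eq_iff forall_3 sum_3
      flip: exp_add)

lemma sqrt_det_sol_metric: "sqrt (det (sol_metric m n p)) = exp ((n - m) * p $ 3)"
proof -
  have "det (sol_metric m n p) = (exp ((n - m) * p $ 3))\<^sup>2"
    by (simp add: det_3 sol_metric_def power2_eq_square algebra_simps flip: exp_add)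
  then show ?thesis by simp
qed

lemma dir_deriv_const: "dir_deriv v (\<lambda>p. c) = (\<lambda>p. 0)"
  by (rule dir_deriv_eqI) simp

lemma dir_deriv_of_coord:
  fixes c :: "real \<Rightarrow> real" and v :: "real ^ 'n"
  assumes "smooth c"
  shows "dir_deriv v (\<lambda>p. c (p $ i)) = (\<lambda>p. v $ i * deriv c (p $ i))"
proof -
  have "dir_deriv v (\<lambda>p. c (p $ i + 0)) = (\<lambda>p. dir_deriv (v $ i) c (p $ i + 0))"
    by (rule dir_deriv_affine_comp[OF assms bounded_linear_vec_nth])
  then show ?thesis
    by (simp add: dir_deriv_real[OF smooth_has_real_derivative[OF assms]])
qed

lemma dir_deriv_exp_coord:
  "dir_deriv v (\<lambda>p::real^'n. exp (c * p $ i)) = (\<lambda>p. v $ i * (c * exp (c * p $ i)))"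
proof -
  have "deriv (\<lambda>t. exp (c * t)) = (\<lambda>t. c * exp (c * t))"
    by (rule ext, rule DERIV_imp_deriv) (auto intro!: derivative_eq_intros)
  then show ?thesis
    by (simp add: dir_deriv_of_coord[OF smooth_exp_linear])
qed

lemma coord_partial_sol_metric:
  "coord_partial i (\<lambda>q. sol_metric m n q $ j $ l) p =
     (if i = 3 \<and> j = 1 \<and> l = 1 then - 2 * m * exp (- 2 * m * p $ 3)
      else if i = 3 \<and> j = 2 \<and> l = 2 then 2 * n * exp (2 * n * p $ 3) else 0)"
  using exhaust_3[of i] exhaust_3[of j] exhaust_3[of l]
  by (auto simp: coord_partial_def sol_metric_def dir_deriv_const axis_def
      dir_deriv_exp_coord[of _ "- (2 * m)", simplified] dir_deriv_exp_coord)

lemma christoffel_sol_metric: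
  "christoffel (sol_metric m n) p k i j =
     (if k = 1 \<and> (i = 1 \<and> j = 3 \<or> i = 3 \<and> j = 1) then - m
      else if k = 2 \<and> (i = 2 \<and> j = 3 \<or> i = 3 \<and> j = 2) then n
      else if k = 3 \<and> i = 1 \<and> j = 1 then m * exp (- 2 * m * p $ 3)
      else if k = 3 \<and> i = 2 \<and> j = 2 then - n * exp (2 * n * p $ 3) else 0)"
proof -
  have "exp (2 * m * p $ 3) * exp (- 2 * m * p $ 3) = 1"
    "exp (- 2 * n * p $ 3) * exp (2 * n * p $ 3) = 1"
    by (simp_all flip: exp_add)
  \<comment> \<open>For \<open>k = 1\<close> and \<open>k = 2\<close> the inverse metric cancels the
    exponential coming from the derivative of the metric, leaving constants; for
    \<open>k = 3\<close> the inverse entry is 1 and the exponential stays.\<close>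
  then have c: "exp (2 * m * p $ 3) * (x * exp (- 2 * m * p $ 3)) = x"
    "exp (- 2 * n * p $ 3) * (x * exp (2 * n * p $ 3)) = x" for x
    by (simp_all add: mult.left_commute[of _ x])
  show ?thesis
    using exhaust_3[of i] exhaust_3[of j] exhaust_3[of k]
    unfolding christoffel_def coord_partial_sol_metric matrix_inv_sol_metric sum_3
    by (elim disjE; use c in simp)
qed

abbreviation comp_deriv :: "'n::finite vfield \<Rightarrow> 'n \<Rightarrow> 'n \<Rightarrow> real ^ 'n \<Rightarrow> real" where
  "comp_deriv W i k \<equiv> dir_deriv (axis i 1) (\<lambda>q. W q $ k)"

lemma levi_civita_sol_metric:
  "levi_civita (sol_metric m n) (axis 1 1) W p $ 1 = comp_deriv W 1 1 p - m * W p $ 3"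
  "levi_civita (sol_metric m n) (axis 1 1) W p $ 2 = comp_deriv W 1 2 p"
  "levi_civita (sol_metric m n) (axis 1 1) W p $ 3 =
     comp_deriv W 1 3 p + m * exp (- 2 * m * p $ 3) * W p $ 1"
  "levi_civita (sol_metric m n) (axis 2 1) W p $ 1 = comp_deriv W 2 1 p"
  "levi_civita (sol_metric m n) (axis 2 1) W p $ 2 = comp_deriv W 2 2 p + n * W p $ 3"
  "levi_civita (sol_metric m n) (axis 2 1) W p $ 3 =
     comp_deriv W 2 3 p - n * exp (2 * n * p $ 3) * W p $ 2"
  "levi_civita (sol_metric m n) (axis 3 1) W p $ 1 = comp_deriv W 3 1 p - m * W p $ 1"
  "levi_civita (sol_metric m n) (axis 3 1) W p $ 2 = comp_deriv W 3 2 p + n * W p $ 2"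
  "levi_civita (sol_metric m n) (axis 3 1) W p $ 3 = comp_deriv W 3 3 p"
  by (simp_all add: levi_civita_def christoffel_sol_metric sum_3 axis_def)

section \<open>The vertical energy as a quadratic form\<close>

definition nabla_inner :: "'n::finite metric \<Rightarrow> 'n vfield \<Rightarrow> 'n vfield \<Rightarrow> real ^ 'n \<Rightarrow> real" where
  "nabla_inner g X V p =
     (\<Sum>i\<in>UNIV. \<Sum>j\<in>UNIV. matrix_inv (g p) $ i $ j *
        metric_inner g p (levi_civita g (axis i 1) X p) (levi_civita g (axis j 1) V p))"

lemma metric_inner_sol_metric:
  "metric_inner (sol_metric m n) p u v =
    exp (- 2 * m * p $ 3) * (u $ 1 * v $ 1) + exp (2 * n * p $ 3) * (u $ 2 * v $ 2) + u $ 3 * v $ 3"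
  by (simp add: metric_inner_def sol_metric_def matrix_vector_mult_def inner_vec_def sum_3)

text \<open>Since the metric is diagonal, only nine products survive. The one with direction
  \<open>i\<close> and component \<open>k\<close> carries the weight \<open>g^{ii} * g_{kk}\<close>,
  which is 1 when \<open>i = k\<close>.\<close>

lemma nabla_inner_sol_metric:
  fixes X V :: "3 vfield" and m n :: real
  defines "A \<equiv> \<lambda>i. levi_civita (sol_metric m n) (axis i 1) X"
    and "B \<equiv> \<lambda>i. levi_civita (sol_metric m n) (axis i 1) V"
  shows "nabla_inner (sol_metric m n) X V p =
      A 1 p $ 1 * B 1 p $ 1
      + exp (2 * (m + n) * p $ 3) * (A 1 p $ 2 * B 1 p $ 2)
      + exp (2 * m * p $ 3) * (A 1 p $ 3 * B 1 p $ 3)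
      + exp (- 2 * (m + n) * p $ 3) * (A 2 p $ 1 * B 2 p $ 1)
      + A 2 p $ 2 * B 2 p $ 2
      + exp (- 2 * n * p $ 3) * (A 2 p $ 3 * B 2 p $ 3)
      + exp (- 2 * m * p $ 3) * (A 3 p $ 1 * B 3 p $ 1)
      + exp (2 * n * p $ 3) * (A 3 p $ 2 * B 3 p $ 2)
      + A 3 p $ 3 * B 3 p $ 3"
proof -
  have e: "exp (2 * (m + n) * p $ 3) = exp (2 * m * p $ 3) * exp (2 * n * p $ 3)"
    "exp (- 2 * (m + n) * p $ 3) = exp (- 2 * m * p $ 3) * exp (- 2 * n * p $ 3)"
    by (simp_all add: algebra_simps flip: exp_add)
  have e1: "exp (2 * m * p $ 3) * exp (- 2 * m * p $ 3) = 1"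
    "exp (- 2 * n * p $ 3) * exp (2 * n * p $ 3) = 1"
    by (simp_all flip: exp_add)
  have c: "exp (2 * m * p $ 3) * (exp (- 2 * m * p $ 3) * x) = x"
    "exp (- 2 * n * p $ 3) * (exp (2 * n * p $ 3) * x) = x" for x
    unfolding mult.assoc[symmetric] e1 by simp_all
  show ?thesis
    unfolding nabla_inner_def metric_inner_sol_metric A_def B_def
      sum_3 matrix_inv_sol_metric vector_3 e
    unfolding distrib_left c
    by (simp add: mult.assoc mult.left_commute)
qed

lemma smooth_exp_coord [intro]: "smooth (\<lambda>p::real^'n. exp (c * p $ i))"
  using smooth_of_coord[OF smooth_exp_linear] .

lemma smooth_levi_civita_sol_metric [intro]:
  assumes "smooth W"
  shows "smooth (\<lambda>p. levi_civita (sol_metric m n) (axis i 1) W p $ k)"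
  using exhaust_3[of i] exhaust_3[of k]
  by (elim disjE; simp only: levi_civita_sol_metric)
    (intro smooth_add smooth_diff smooth_mult smooth_const smooth_exp_coord smooth_nth
      smooth_dir_deriv assms)+

lemma smooth_nabla_inner_sol_metric:
  assumes "smooth X" "smooth V"
  shows "smooth (nabla_inner (sol_metric m n) X V)"
  unfolding nabla_inner_sol_metric[abs_def]
  by (intro smooth_add smooth_mult smooth_exp_coord smooth_levi_civita_sol_metric assms)

lemma nabla_norm_sq_variation:
  assumes "smooth X" "smooth V"
  shows "nabla_norm_sq (sol_metric m n) (\<lambda>p. X p + s *\<^sub>R V p) p =
    nabla_norm_sq (sol_metric m n) X p + 2 * s * nabla_inner (sol_metric m n) X V p
      + s\<^sup>2 * nabla_norm_sq (sol_metric m n) V p"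
proof -
  have q: "nabla_norm_sq g W = nabla_inner g W W" for g :: "3 metric" and W
    by (simp add: fun_eq_iff nabla_norm_sq_def nabla_inner_def)
  show ?thesis
    unfolding q nabla_inner_sol_metric levi_civita_add_scaleR[OF assms]
    by (simp add: power2_eq_square algebra_simps)
qed

text \<open>No differentiation under the integral sign is involved: the integrand is quadratic in
  \<open>s\<close> with coefficients continuous on the compact \<open>D\<close>, so the energy is a
  quadratic polynomial in \<open>s\<close> and the derivative at 0 is its linear
  coefficient.\<close>

lemma vertical_energy_variation:
  assumes X: "smooth X" and V: "smooth V" and D: "compact D"
  shows "((\<lambda>s. vertical_energy (sol_metric m n) D (\<lambda>p. X p + s *\<^sub>R V p)) has_real_derivative
     set_lebesgue_integral lborel D
       (\<lambda>p. nabla_inner (sol_metric m n) X V p * exp ((n - m) * p $ 3))) (at 0)"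
proof -
  let ?g = "sol_metric m n"
  let ?I = "\<lambda>Y Z. set_lebesgue_integral lborel D (\<lambda>p. nabla_inner ?g Y Z p * exp ((n - m) * p $ 3))"
  have int: "set_integrable lborel D (\<lambda>p. nabla_inner ?g Y Z p * exp ((n - m) * p $ 3))"
    if "smooth Y" "smooth Z" for Y Z
    unfolding set_integrable_def
    by (intro borel_integrable_compact D smooth_continuous_on smooth_mult smooth_exp_coord
        smooth_nabla_inner_sol_metric that)
  have q: "nabla_norm_sq ?g W = nabla_inner ?g W W" for W
    by (simp add: fun_eq_iff nabla_norm_sq_def nabla_inner_def)
  have "vertical_energy ?g D (\<lambda>p. X p + s *\<^sub>R V p) =
      (1/2) * ?I X X + s * ?I X V + s\<^sup>2 * ((1/2) * ?I V V)" for s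
  proof -
    have "set_lebesgue_integral lborel D
        (\<lambda>p. nabla_norm_sq ?g (\<lambda>p. X p + s *\<^sub>R V p) p * sqrt (det (?g p))) =
      set_lebesgue_integral lborel D
        (\<lambda>p. (nabla_inner ?g X X p * exp ((n - m) * p $ 3)
          + (2 * s) * (nabla_inner ?g X V p * exp ((n - m) * p $ 3)))
          + s\<^sup>2 * (nabla_inner ?g V V p * exp ((n - m) * p $ 3)))"
      unfolding sqrt_det_sol_metric nabla_norm_sq_variation[OF X V]
      unfolding q
      by (rule arg_cong[where f = "set_lebesgue_integral lborel D"])
        (simp add: fun_eq_iff algebra_simps)
    also have "\<dots> = (?I X X + 2 * s * ?I X V) + s\<^sup>2 * ?I V V"
      by (simp add: int X V)
    finally show ?thesis
      unfolding vertical_energy_def by (simp add: algebra_simps)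
  qed
  then show ?thesis
    by (auto intro!: derivative_eq_intros)
qed

text \<open>Only \<open>X\<close> is assumed smooth. Restricting it to the \<open>t\<close>-axis and
  removing the exponential factors of \<open>sol_e1\<close> and \<open>sol_e2\<close> recovers the
  three functions.\<close>

lemma smooth_sol_components:
  fixes X :: "3 vfield"
  assumes X: "\<And>p. X p = X1 (p $ 3) *\<^sub>R sol_e1 m p + X2 (p $ 3) *\<^sub>R sol_e2 n p + X3 (p $ 3) *\<^sub>R sol_e3 p"
    and "smooth X"
  shows "smooth X1" "smooth X2" "smooth X3"
proof -
  have s: "smooth (\<lambda>t::real. X (t *\<^sub>R axis 3 1) $ k)" for k
    by (rule smooth_linear_comp[OF smooth_nth[OF assms(2)] bounded_linear_scaleR_left])
  have "X1 = (\<lambda>t. exp ((- m) * t) * X (t *\<^sub>R axis 3 1) $ 1)"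
    "X2 = (\<lambda>t. exp (n * t) * X (t *\<^sub>R axis 3 1) $ 2)"
    "X3 = (\<lambda>t. X (t *\<^sub>R axis 3 1) $ 3)"
    by (simp_all add: fun_eq_iff X sol_e1_def sol_e2_def sol_e3_def axis_def flip: exp_add)
  then show "smooth X1" "smooth X2" "smooth X3"
    using smooth_mult[OF smooth_exp_linear s] s by metis+
qed

lemma deriv_mult_exp:
  fixes c :: "real \<Rightarrow> real"
  assumes "smooth c"
  shows "deriv (\<lambda>t. exp (k * t) * c t) t = exp (k * t) * (deriv c t + k * c t)"
  by (rule DERIV_imp_deriv)
    (auto intro!: derivative_eq_intros smooth_has_real_derivative[OF assms] simp: algebra_simps)

lemma dir_deriv_coord_times_component:
  assumes "smooth c" "smooth V"
  shows "dir_deriv (axis i 1) (\<lambda>p. c (p $ 3) * V p $ k) p =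
    c (p $ 3) * comp_deriv V i k p + (if i = (3::3) then deriv c (p $ 3) * V p $ k else 0)"
  by (simp add: dir_deriv_mult[OF smooth_of_coord[OF assms(1)] smooth_nth[OF assms(2)]]
      dir_deriv_of_coord[OF assms(1)] axis_def)

section \<open>Divergence form of the first variation\<close>

context
  fixes m n :: real and X1 X2 X3 :: "real \<Rightarrow> real"
begin

text \<open>Each weight is the volume density \<open>exp ((n - m) t)\<close> times the factor turning a coordinate
  component of a variation into its component in the frame \<open>e\<^sub>1, e\<^sub>2, e\<^sub>3\<close>.\<close>

definition el_residual :: "3 vfield" where
  "el_residual p = (let t = p $ 3 in vector
     [exp ((n - 2 * m) * t) * (deriv (deriv X1) t + (n - m) * deriv X1 t - m\<^sup>2 * X1 t),
      exp ((2 * n - m) * t) * (deriv (deriv X2) t + (n - m) * deriv X2 t - n\<^sup>2 * X2 t),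
      exp ((n - m) * t) * (deriv (deriv X3) t + (n - m) * deriv X3 t - (m\<^sup>2 + n\<^sup>2) * X3 t)])"

text \<open>For \<open>i = 1, 2, 3\<close> the fluxes are
  \<open>sqrt(det g) * g^{ii} * g(nabla_i X, V)\<close>, written out in coordinates. The frame is
  parallel along the \<open>t\<close>-lines, which is why the third one involves only the
  derivatives of \<open>X1\<close>, \<open>X2\<close>, \<open>X3\<close>.\<close>

definition flux1 :: "3 vfield \<Rightarrow> real ^ 3 \<Rightarrow> real" where
  "flux1 V p = exp ((n - m) * p $ 3) * (- m * X3 (p $ 3)) * V p $ 1
     + exp (n * p $ 3) * (m * X1 (p $ 3)) * V p $ 3"

definition flux2 :: "3 vfield \<Rightarrow> real ^ 3 \<Rightarrow> real" where
  "flux2 V p = exp ((n - m) * p $ 3) * (n * X3 (p $ 3)) * V p $ 2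
     + exp ((- m) * p $ 3) * (- n * X2 (p $ 3)) * V p $ 3"

definition flux3 :: "3 vfield \<Rightarrow> real ^ 3 \<Rightarrow> real" where
  "flux3 V p = exp ((n - 2 * m) * p $ 3) * deriv X1 (p $ 3) * V p $ 1
     + exp ((2 * n - m) * p $ 3) * deriv X2 (p $ 3) * V p $ 2
     + exp ((n - m) * p $ 3) * deriv X3 (p $ 3) * V p $ 3"

context
  fixes X :: "3 vfield"
  assumes X: "X = (\<lambda>p. X1 (p $ 3) *\<^sub>R sol_e1 m p + X2 (p $ 3) *\<^sub>R sol_e2 n p + X3 (p $ 3) *\<^sub>R sol_e3 p)"
    and smooth_X: "smooth X1" "smooth X2" "smooth X3"
begin

lemma comp_deriv_X:
  "comp_deriv X i 1 p = (if i = 3 then exp (m * p $ 3) * (deriv X1 (p $ 3) + m * X1 (p $ 3)) else 0)"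
  "comp_deriv X i 2 p = (if i = 3 then exp ((- n) * p $ 3) * (deriv X2 (p $ 3) + (- n) * X2 (p $ 3)) else 0)"
  "comp_deriv X i 3 p = (if i = 3 then deriv X3 (p $ 3) else 0)"
proof -
  have c: "(\<lambda>p. X p $ 1) = (\<lambda>p. exp (m * p $ 3) * X1 (p $ 3))"
    "(\<lambda>p. X p $ 2) = (\<lambda>p. exp ((- n) * p $ 3) * X2 (p $ 3))"
    "(\<lambda>p. X p $ 3) = (\<lambda>p. X3 (p $ 3))"
    by (simp_all add: fun_eq_iff X sol_e1_def sol_e2_def sol_e3_def axis_def)
  show "comp_deriv X i 1 p = (if i = 3 then exp (m * p $ 3) * (deriv X1 (p $ 3) + m * X1 (p $ 3)) else 0)"
    unfolding c dir_deriv_of_coord[OF smooth_mult[OF smooth_exp_linear smooth_X(1)]]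
      deriv_mult_exp[OF smooth_X(1)] by (simp add: axis_def)
  show "comp_deriv X i 2 p = (if i = 3 then exp ((- n) * p $ 3) * (deriv X2 (p $ 3) + (- n) * X2 (p $ 3)) else 0)"
    unfolding c dir_deriv_of_coord[OF smooth_mult[OF smooth_exp_linear smooth_X(2)]]
      deriv_mult_exp[OF smooth_X(2)] by (simp add: axis_def)
  show "comp_deriv X i 3 p = (if i = 3 then deriv X3 (p $ 3) else 0)"
    unfolding c dir_deriv_of_coord[OF smooth_X(3)] by (simp add: axis_def)
qed

lemma smooth_weights:
  "smooth (\<lambda>t. exp ((n - m) * t) * (- m * X3 t))"
  "smooth (\<lambda>t. exp (n * t) * (m * X1 t))"
  "smooth (\<lambda>t. exp ((n - m) * t) * (n * X3 t))"
  "smooth (\<lambda>t. exp ((- m) * t) * (- n * X2 t))"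
  "smooth (\<lambda>t. exp ((n - 2 * m) * t) * deriv X1 t)"
  "smooth (\<lambda>t. exp ((2 * n - m) * t) * deriv X2 t)"
  "smooth (\<lambda>t. exp ((n - m) * t) * deriv X3 t)"
  by (intro smooth_mult smooth_exp_linear smooth_const smooth_X smooth_deriv)+

lemma smooth_flux:
  assumes "smooth V"
  shows "smooth (flux1 V)" "smooth (flux2 V)" "smooth (flux3 V)"
  unfolding flux1_def[abs_def] flux2_def[abs_def] flux3_def[abs_def]
  by (intro smooth_add smooth_mult[OF _ smooth_nth[OF assms]] smooth_weights[THEN smooth_of_coord])+

text \<open>The coefficients depend on \<open>t\<close> alone, so derivatives in \<open>x\<close>
  and \<open>y\<close> fall on \<open>V\<close> only, and second derivatives of the components arise
  only from \<open>flux3\<close>.\<close>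

lemma dir_deriv_flux:
  assumes V: "smooth V"
  shows "dir_deriv (axis 1 1) (flux1 V) p =
      exp ((n - m) * p $ 3) * (- m * X3 (p $ 3)) * comp_deriv V 1 1 p
      + exp (n * p $ 3) * (m * X1 (p $ 3)) * comp_deriv V 1 3 p"
    "dir_deriv (axis 2 1) (flux2 V) p =
      exp ((n - m) * p $ 3) * (n * X3 (p $ 3)) * comp_deriv V 2 2 p
      + exp ((- m) * p $ 3) * (- n * X2 (p $ 3)) * comp_deriv V 2 3 p"
    "dir_deriv (axis 3 1) (flux3 V) p =
      exp ((n - 2 * m) * p $ 3) * (deriv X1 (p $ 3) * comp_deriv V 3 1 p
        + (deriv (deriv X1) (p $ 3) + (n - 2 * m) * deriv X1 (p $ 3)) * V p $ 1)
      + exp ((2 * n - m) * p $ 3) * (deriv X2 (p $ 3) * comp_deriv V 3 2 p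
        + (deriv (deriv X2) (p $ 3) + (2 * n - m) * deriv X2 (p $ 3)) * V p $ 2)
      + exp ((n - m) * p $ 3) * (deriv X3 (p $ 3) * comp_deriv V 3 3 p
        + (deriv (deriv X3) (p $ 3) + (n - m) * deriv X3 (p $ 3)) * V p $ 3)"
proof -
  have s: "smooth (\<lambda>p. c (p $ 3) * V p $ k)" if "smooth c" for c :: "real \<Rightarrow> real" and k
    by (intro smooth_mult smooth_nth V smooth_of_coord that)
  note sw = smooth_weights[THEN s]
  note d = smooth_weights[THEN dir_deriv_coord_times_component[OF _ V]]
  show "dir_deriv (axis 1 1) (flux1 V) p =
      exp ((n - m) * p $ 3) * (- m * X3 (p $ 3)) * comp_deriv V 1 1 p
      + exp (n * p $ 3) * (m * X1 (p $ 3)) * comp_deriv V 1 3 p"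
    unfolding flux1_def[abs_def] dir_deriv_add[OF sw(1,2)] d by simp
  show "dir_deriv (axis 2 1) (flux2 V) p =
      exp ((n - m) * p $ 3) * (n * X3 (p $ 3)) * comp_deriv V 2 2 p
      + exp ((- m) * p $ 3) * (- n * X2 (p $ 3)) * comp_deriv V 2 3 p"
    unfolding flux2_def[abs_def] dir_deriv_add[OF sw(3,4)] d by simp
  show "dir_deriv (axis 3 1) (flux3 V) p =
      exp ((n - 2 * m) * p $ 3) * (deriv X1 (p $ 3) * comp_deriv V 3 1 p
        + (deriv (deriv X1) (p $ 3) + (n - 2 * m) * deriv X1 (p $ 3)) * V p $ 1)
      + exp ((2 * n - m) * p $ 3) * (deriv X2 (p $ 3) * comp_deriv V 3 2 p
        + (deriv (deriv X2) (p $ 3) + (2 * n - m) * deriv X2 (p $ 3)) * V p $ 2)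
      + exp ((n - m) * p $ 3) * (deriv X3 (p $ 3) * comp_deriv V 3 3 p
        + (deriv (deriv X3) (p $ 3) + (n - m) * deriv X3 (p $ 3)) * V p $ 3)"
    unfolding flux3_def[abs_def] dir_deriv_add[OF smooth_add[OF sw(5,6)] sw(7)]
      dir_deriv_add[OF sw(5,6)] d smooth_X[THEN smooth_deriv, THEN deriv_mult_exp]
    by (simp add: algebra_simps)
qed

text \<open>Terms with derivatives of \<open>V\<close> agree with those in the divergence. Among the
  terms of order zero in \<open>V\<close>, direction 1 yields \<open>m^2\<close> for
  \<open>X1\<close> and \<open>X3\<close>, direction 2 yields \<open>n^2\<close> for
  \<open>X2\<close> and \<open>X3\<close>, and direction 3 shifts the coefficients
  \<open>n - 2 * m\<close> and \<open>2 * n - m\<close> from \<open>flux3\<close> to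
  \<open>n - m\<close>.\<close>

lemma nabla_inner_eq_divergence:
  assumes V: "smooth V"
  shows "nabla_inner (sol_metric m n) X V p * exp ((n - m) * p $ 3) =
    dir_deriv (axis 1 1) (flux1 V) p + dir_deriv (axis 2 1) (flux2 V) p
    + dir_deriv (axis 3 1) (flux3 V) p - el_residual p \<bullet> V p"
proof -
  define t where "t = p $ 3"
  \<comment> \<open>Treating the exponentials as four unknowns subject to \<open>E * e = 1\<close>
    and \<open>G * j = 1\<close> reduces the claim to a polynomial identity.\<close>
  define E e G j where "E = exp (m * t)" and "e = exp (- m * t)" and "G = exp (n * t)" and "j = exp (- n * t)"
  note defs = E_def e_def G_def j_def
  have Ee: "E * e = 1" and Gj: "G * j = 1" by (simp_all add: defs flip: exp_add)
  have x: "exp ((n - m) * t) = G * e" "exp (n * t) = G" "exp (m * t) = E" "exp ((- m) * t) = e"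
    "exp ((- n) * t) = j"
    "exp ((n - 2 * m) * t) = G * e * e" "exp ((2 * n - m) * t) = G * G * e"
    "exp (2 * m * t) = E * E" "exp (2 * n * t) = G * G"
    "exp (- 2 * m * t) = e * e" "exp (- 2 * n * t) = j * j"
    "X p $ 1 = E * X1 t" "X p $ 2 = j * X2 t" "X p $ 3 = X3 t"
    by (simp_all add: defs X sol_e1_def sol_e2_def sol_e3_def axis_def t_def algebra_simps flip: exp_add)
  \<comment> \<open>These are the products of third components in directions 1 and 2. The literal
    \<open>0\<close> is the vanishing derivative of \<open>X3\<close> in \<open>x\<close> or
    \<open>y\<close>; \<open>d\<close> and \<open>v\<close> stand for the derivative and the value
    of components of \<open>V\<close>.\<close>
  have k1: "E * E * ((0 + m * (e * e) * (E * x)) * (d + m * (e * e) * v)) * (G * e)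
      = G * (m * x) * d + G * e * e * m\<^sup>2 * x * v" for x d v
    using Ee by algebra
  have k2: "j * j * ((0 - n * (G * G) * (j * x)) * (d - n * (G * G) * v)) * (G * e)
      = e * (- n * x) * d + G * G * e * n\<^sup>2 * x * v" for x d v
    using Gj by algebra
  have c: "E * (G * (e * z)) = G * z" "G * (e * (j * z)) = e * z" for z
    using Ee Gj by algebra+
  have "(1::3) \<noteq> 3" "(2::3) \<noteq> 3" by simp_all
  note if_3 = this[THEN if_not_P]
  show ?thesis
    unfolding nabla_inner_sol_metric levi_civita_sol_metric comp_deriv_X dir_deriv_flux[OF V]
      el_residual_def Let_def inner_vec_def sum_3 t_def[symmetric] vector_3 inner_real_def
      if_3 if_True refl
    unfolding x distrib_right[of _ _ "G * e"] k1 k2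
    by (simp add: power2_eq_square algebra_simps c)
qed

lemma smooth_el_residual: "smooth (\<lambda>p. el_residual p $ k)"
proof -
  have "smooth (\<lambda>t. exp ((n - 2 * m) * t) * (deriv (deriv X1) t + (n - m) * deriv X1 t - m\<^sup>2 * X1 t))"
    "smooth (\<lambda>t. exp ((2 * n - m) * t) * (deriv (deriv X2) t + (n - m) * deriv X2 t - n\<^sup>2 * X2 t))"
    "smooth (\<lambda>t. exp ((n - m) * t) * (deriv (deriv X3) t + (n - m) * deriv X3 t - (m\<^sup>2 + n\<^sup>2) * X3 t))"
    by (intro smooth_mult smooth_add smooth_diff smooth_exp_linear smooth_const smooth_deriv smooth_X)+
  note this[THEN smooth_of_coord]
  then show ?thesis
    using exhaust_3[of k] by (auto simp: el_residual_def Let_def)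
qed

text \<open>Each flux is pointwise linear in \<open>V\<close>, so it vanishes off \<open>D\<close>
  together with its derivatives. Integrating its derivative over \<open>D\<close> is then the same
  as over the whole space and gives zero.\<close>

lemma first_variation_eq:
  assumes V: "smooth V" and D: "compact D" and supp: "closure {p. V p \<noteq> 0} \<subseteq> D"
  shows "set_lebesgue_integral lborel D
      (\<lambda>p. nabla_inner (sol_metric m n) X V p * exp ((n - m) * p $ 3)) =
    - set_lebesgue_integral lborel D (\<lambda>p. el_residual p \<bullet> V p)"
proof -
  have V0: "V p = 0" if "p \<notin> D" for p
    using supp closure_subset[of "{p. V p \<noteq> 0}"] that by blast
  have int0: "set_lebesgue_integral lborel D (dir_deriv v F) = 0"
    and int: "set_integrable lborel D (dir_deriv v F)"
    if F: "smooth F" and F0: "\<And>p. V p = 0 \<Longrightarrow> F p = 0" for v and F :: "real^3 \<Rightarrow> real"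
  proof -
    have cl: "closure {p. F p \<noteq> 0} \<subseteq> closure {p. V p \<noteq> 0}"
      using F0 by (intro closure_mono) auto
    then have "dir_deriv v F p = 0" if "p \<notin> D" for p
      using dir_deriv_eq_0_outside[of p F v] supp that by blast
    then have "(\<lambda>p. indicator D p *\<^sub>R dir_deriv v F p) = dir_deriv v F"
      by (auto simp: fun_eq_iff indicator_def)
    then show "set_lebesgue_integral lborel D (dir_deriv v F) = 0"
      unfolding set_lebesgue_integral_def
      using integral_dir_deriv_eq_0[OF F D] F0 V0 by simp
    show "set_integrable lborel D (dir_deriv v F)"
      unfolding set_integrable_def
      by (intro borel_integrable_compact D smooth_continuous_on smooth_dir_deriv F)
  qed
  have sr: "smooth (\<lambda>p. el_residual p \<bullet> V p)"
    unfolding inner_vec_def sum_3 inner_real_def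
    by (intro smooth_add smooth_mult smooth_nth V smooth_el_residual)
  have ir: "set_integrable lborel D (\<lambda>p. el_residual p \<bullet> V p)"
    unfolding set_integrable_def
    by (intro borel_integrable_compact D smooth_continuous_on sr)
  have f0: "flux1 V p = 0" "flux2 V p = 0" "flux3 V p = 0" if "V p = 0" for p
    using that by (simp_all add: flux1_def flux2_def flux3_def)
  note s = smooth_flux[OF V]
  show ?thesis
    unfolding nabla_inner_eq_divergence[OF V]
    using int[OF s(1) f0(1)] int[OF s(2) f0(2)] int[OF s(3) f0(3)] ir
      int0[OF s(1) f0(1)] int0[OF s(2) f0(2)] int0[OF s(3) f0(3)]
    by (simp add: set_integral_diff set_integral_add)
qed

section \<open>Critical points and the residual\<close>

lemma harmonic_section_iff_residual:
  assumes "smooth X"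
  shows "harmonic_section (sol_metric m n) X \<longleftrightarrow> (\<forall>p. el_residual p = 0)"
proof
  assume R: "\<forall>p. el_residual p = 0"
  show "harmonic_section (sol_metric m n) X"
    unfolding harmonic_section_def
  proof (intro conjI allI impI assms)
    fix D :: "(real ^ 3) set" and V :: "3 vfield"
    assume A: "compact_domain D \<and> smooth V \<and> closure {p. V p \<noteq> 0} \<subseteq> D"
    then have D: "compact D" by (simp add: compact_domain_def)
    show "((\<lambda>s. vertical_energy (sol_metric m n) D (\<lambda>p. X p + s *\<^sub>R V p)) has_real_derivative 0) (at 0)"
      using vertical_energy_variation[OF assms _ D, of V m n] first_variation_eq[OF _ D, of V] A R
      by (simp add: set_lebesgue_integral_def)
  qed
next
  assume H: "harmonic_section (sol_metric m n) X"
  show "\<forall>p. el_residual p = 0"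
  proof (rule ccontr)
    assume "\<not> (\<forall>p. el_residual p = 0)"
    then obtain p0 k where "el_residual p0 $ k \<noteq> 0"
      by (auto simp: vec_eq_iff)
    moreover have "continuous_on UNIV (\<lambda>p. el_residual p $ k)"
      by (rule smooth_continuous_on[OF smooth_el_residual])
    ultimately obtain D \<eta> where \<eta>: "compact_domain D" "smooth \<eta>" "closure {p. \<eta> p \<noteq> 0} \<subseteq> D"
      "set_lebesgue_integral lborel D (\<lambda>p. el_residual p $ k * \<eta> p) \<noteq> 0"
      using exists_test_function by blast
    \<comment> \<open>A variation in the single coordinate direction \<open>k\<close> isolates the
      nonzero component of the residual.\<close>
    define V where "V = (\<lambda>p. \<eta> p *\<^sub>R axis k (1::real))"
    have V: "smooth V" unfolding V_def by (intro smooth_scaleR_const \<eta>(2))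
    have "{p. V p \<noteq> 0} = {p. \<eta> p \<noteq> 0}" by (auto simp: V_def axis_eq_0_iff)
    then have supp: "closure {p. V p \<noteq> 0} \<subseteq> D" using \<eta>(3) by simp
    have D: "compact D" using \<eta>(1) by (simp add: compact_domain_def)
    have "((\<lambda>s. vertical_energy (sol_metric m n) D (\<lambda>p. X p + s *\<^sub>R V p)) has_real_derivative 0) (at 0)"
      using H \<eta>(1) V supp unfolding harmonic_section_def by blast
    from DERIV_unique[OF this vertical_energy_variation[OF assms V D]]
    have "set_lebesgue_integral lborel D (\<lambda>p. el_residual p \<bullet> V p) = 0"
      unfolding first_variation_eq[OF V D supp] by simp
    then show False using \<eta>(4) by (simp add: V_def inner_axis mult.commute)
  qed
qed

end

end

theorem theorem9:
  fixes m n :: real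
    and X1 X2 X3 :: "real \<Rightarrow> real"
    and X :: "real ^ 3 \<Rightarrow> real ^ 3"
  assumes "m > 0" and "n > 0"
    and "\<And>p. X p = X1 (p $ 3) *\<^sub>R sol_e1 m p + X2 (p $ 3) *\<^sub>R sol_e2 n p + X3 (p $ 3) *\<^sub>R sol_e3 p"
    and "smooth X"
  shows "harmonic_section (sol_metric m n) X \<longleftrightarrow>
    (\<forall>t. deriv (deriv X1) t + (n - m) * deriv X1 t - m\<^sup>2 * X1 t = 0) \<and>
    (\<forall>t. deriv (deriv X2) t + (n - m) * deriv X2 t - n\<^sup>2 * X2 t = 0) \<and>
    (\<forall>t. deriv (deriv X3) t + (n - m) * deriv X3 t - (m\<^sup>2 + n\<^sup>2) * X3 t = 0)"
proof -
  have "X = (\<lambda>p. X1 (p $ 3) *\<^sub>R sol_e1 m p + X2 (p $ 3) *\<^sub>R sol_e2 n p + X3 (p $ 3) *\<^sub>R sol_e3 p)"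
    using assms(3) by blast
  note R = harmonic_section_iff_residual[OF this smooth_sol_components[OF assms(3,4)] assms(4)]
  \<comment> \<open>Every real \<open>t\<close> is the third coordinate of some point, for instance
    of \<open>vec t\<close>.\<close>
  have coord: "(\<forall>p::real^3. P (p $ 3)) \<longleftrightarrow> (\<forall>t. P t)" for P :: "real \<Rightarrow> bool"
    by (metis vec_component)
  \<comment> \<open>The exponential weights never vanish, so each component of the residual is zero
    exactly when its bracket is.\<close>
  have "(\<forall>p. el_residual m n X1 X2 X3 p = 0) \<longleftrightarrow> (\<forall>p::real^3.
      (deriv (deriv X1) (p $ 3) + (n - m) * deriv X1 (p $ 3) - m\<^sup>2 * X1 (p $ 3) = 0 \<and>
       deriv (deriv X2) (p $ 3) + (n - m) * deriv X2 (p $ 3) - n\<^sup>2 * X2 (p $ 3) = 0 \<and>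
       deriv (deriv X3) (p $ 3) + (n - m) * deriv X3 (p $ 3) - (m\<^sup>2 + n\<^sup>2) * X3 (p $ 3) = 0))"
    by (simp add: el_residual_def Let_def vec_eq_iff forall_3)
  also have "\<dots> \<longleftrightarrow> (\<forall>t.
      (deriv (deriv X1) t + (n - m) * deriv X1 t - m\<^sup>2 * X1 t = 0 \<and>
       deriv (deriv X2) t + (n - m) * deriv X2 t - n\<^sup>2 * X2 t = 0 \<and>
       deriv (deriv X3) t + (n - m) * deriv X3 t - (m\<^sup>2 + n\<^sup>2) * X3 t = 0))"
    by (rule coord)
  finally show ?thesis unfolding R by blast
qed

end
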